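(* The class of functions $f:\mathbb{N}\to\mathbb{N}$ that can be computed in polynomial time by an $\mathrm{ASRAM}[+,\dot{-},\times,\div]$ is strictly larger than the class of functions that can be computed in polynomial time by an $\mathrm{ARAM}[+,\dot{-},\times,\div]$.
   Context: A $\mathrm{RAM}[\mathit{op}]$ is a unit-cost random access machine with registers $R[0],R[1],\dots$ holding nonnegative integers, with direct and indirect addressing, conditional jumps, an equality comparator, and the operations in the set $\mathit{op}$, each executed in one unit of time. On input $\mathit{inp}$ (a nonnegative integer, or a fixed number of them) the input is placed in $R[0]$, all other registers are $0$, and the output is the value of $R[0]$ at termination. Here $a\dot{-}b=\max(a-b,0)$ and $\div$ is integer division (quotient rounded down). ARAM: an $\mathrm{ARAM}[\mathit{op}]$ is given by a $\mathrm{RAM}[\mathit{op}]$ program $r$ computing a two-argument function $\rho(\mathit{inp},A)$; it computes $\rho_A$ if for every $\mathit{inp}$, $\rho(\mathit{inp},A)=\rho_A(\mathit{inp})$ for all but finitely many $A$. Its running time on $\mathit{inp}$ is the supremum over all $A$ of the running time of $r$ on $(\mathit{inp},A)$. ALS set: a nonempty set $\mathbf{S}$ of infinite integer sequences such that for every $i$ and every $\{A_k\}\in\mathbf{S}$ there is $\{B_k\}\in\mathbf{S}$ with $B_i=A_i+1$ and $B_j=A_j$ for all $j<i$. ASRAM: an $\mathrm{ASRAM}[\mathit{op}]$ is a $\mathrm{RAM}[\mathit{op}]$ program that may additionally call a pseudofunction $\mathit{ALN}()$ returning an integer. It computes $f$ if for each $\mathit{inp}$ there is an ALS set $\mathbf{S}$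 such that for every $\{A_i\}\in\mathbf{S}$, replacing the $i$-th invocation of $\mathit{ALN}()$ by the constant $A_i$ yields a RAM computing $f(\mathit{inp})$ on input $\mathit{inp}$. Its running time on $\mathit{inp}$ is the worst case over all choices of the sequence $\{A_i\}$ of the running time of the resulting RAM. Polynomial time means running time bounded by a polynomial in the bit-length of the input. *)

theory Defs
  imports Main
begin

text \<open>Instructions. Register indices in instructions are constants (direct addressing);
  Ld/St provide indirect addressing. Jeq i j l jumps to l if R[i] = R[j]
  (an unconditional jump is Jeq 0 0 l). Aln i sets R[i] := ALN() and is only
  permitted in ASRAM programs.\<close>
datatype instr =
    Cnst nat nat
  | Cpy nat nat
  | Ld nat nat
  | St nat nat
  | Add nat nat nat
  | Sub nat nat nat
  | Mul nat nat nat
  | Dv nat nat nat          (* R[i] := R[j] div R[k]  (x div 0 = 0) *)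
  | Jeq nat nat nat
  | Aln nat
  | Halt

type_synonym prog = "instr list"

text \<open>Configuration: program counter, registers, number of ALN() calls performed so far.\<close>
type_synonym config = "nat \<times> (nat \<Rightarrow> nat) \<times> nat"

definition halted :: "prog \<Rightarrow> config \<Rightarrow> bool" where
  "halted P c = (fst c \<ge> length P \<or> P ! fst c = Halt)"

text \<open>One step; the i-th (0-based) invocation of ALN() returns seq i. Since registers
  hold nonnegative integers, a negative value returned by ALN() is stored as 0.\<close>
fun exec :: "instr \<Rightarrow> (nat \<Rightarrow> int) \<Rightarrow> config \<Rightarrow> config" where
  "exec (Cnst i c) s (pc, R, n) = (Suc pc, R(i := c), n)"
| "exec (Cpy i j) s (pc, R, n) = (Suc pc, R(i := R j), n)"
| "exec (Ld i j) s (pc, R, n) = (Suc pc, R(i := R (R j)), n)"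
| "exec (St i j) s (pc, R, n) = (Suc pc, R(R i := R j), n)"
| "exec (Add i j k) s (pc, R, n) = (Suc pc, R(i := R j + R k), n)"
| "exec (Sub i j k) s (pc, R, n) = (Suc pc, R(i := R j - R k), n)"
| "exec (Mul i j k) s (pc, R, n) = (Suc pc, R(i := R j * R k), n)"
| "exec (Dv i j k) s (pc, R, n) = (Suc pc, R(i := R j div R k), n)"
| "exec (Jeq i j l) s (pc, R, n) = ((if R i = R j then l else Suc pc), R, n)"
| "exec (Aln i) s (pc, R, n) = (Suc pc, R(i := nat (s n)), Suc n)"
| "exec Halt s (pc, R, n) = (pc, R, n)"

definition step :: "prog \<Rightarrow> (nat \<Rightarrow> int) \<Rightarrow> config \<Rightarrow> config" where
  "step P s c = (if halted P c then c else exec (P ! fst c) s c)"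

definition init :: "nat list \<Rightarrow> config" where
  "init xs = (0, (\<lambda>i. if i < length xs then xs ! i else 0), 0)"

definition run :: "prog \<Rightarrow> (nat \<Rightarrow> int) \<Rightarrow> nat list \<Rightarrow> nat \<Rightarrow> config" where
  "run P s xs t = (step P s ^^ t) (init xs)"

definition halts_within :: "prog \<Rightarrow> (nat \<Rightarrow> int) \<Rightarrow> nat list \<Rightarrow> nat \<Rightarrow> bool" where
  "halts_within P s xs t = (\<exists>t'\<le>t. halted P (run P s xs t'))"

definition outputs :: "prog \<Rightarrow> (nat \<Rightarrow> int) \<Rightarrow> nat list \<Rightarrow> nat \<Rightarrow> bool" where
  "outputs P s xs y = (\<exists>t. halted P (run P s xs t) \<and> fst (snd (run P s xs t)) 0 = y)"

definition no_aln :: "prog \<Rightarrow> bool" where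
  "no_aln P = (\<forall>i. Aln i \<notin> set P)"

text \<open>Bit-length of a natural number (bitlen 0 = 0).\<close>
definition bitlen :: "nat \<Rightarrow> nat" where
  "bitlen n = (LEAST k. n < 2 ^ k)"

definition poly_bound :: "nat \<Rightarrow> nat \<Rightarrow> nat \<Rightarrow> nat" where
  "poly_bound c k n = c * (bitlen n + 1) ^ k"

definition ARAM_ptime :: "(nat \<Rightarrow> nat) \<Rightarrow> bool" where
  "ARAM_ptime f = (\<exists>r c k. no_aln r \<and>
      (\<forall>inp A. halts_within r (\<lambda>_. 0) [inp, A] (poly_bound c k inp)) \<and>
      (\<forall>inp. finite {A. \<not> outputs r (\<lambda>_. 0) [inp, A] (f inp)}))"

definition ALS :: "(nat \<Rightarrow> int) set \<Rightarrow> bool" where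
  "ALS S = (S \<noteq> {} \<and>
     (\<forall>i. \<forall>a\<in>S. \<exists>b\<in>S. b i = a i + 1 \<and> (\<forall>j<i. b j = a j)))"

definition ASRAM_ptime :: "(nat \<Rightarrow> nat) \<Rightarrow> bool" where
  "ASRAM_ptime f = (\<exists>P c k.
      (\<forall>inp s. halts_within P s [inp] (poly_bound c k inp)) \<and>
      (\<forall>inp. \<exists>S. ALS S \<and> (\<forall>s\<in>S. outputs P s [inp] (f inp))))"

end

theory Submission
  imports Defs "HOL-Computational_Algebra.Polynomial"
begin

text \<open>
  An ARAM is an ASRAM that calls ALN() once, at the start. The function separating the two classes
  is \<open>2 ^ 2 ^ 2 ^ n\<close>, where \<open>n\<close> is the bit length of the input.

  An ASRAM computes it from large numbers \<open>a\<^sub>1, \<dots>, a\<^sub>n\<close>, each much larger than its predecessor,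
  and \<open>a\<^sub>0 = 2\<close>. Because \<open>a ^ d mod (a - x) = x ^ d\<close> for large \<open>a\<close>, possessing \<open>a\<^sub>i\<^sub>+\<^sub>1 ^ d\<close> amounts to
  possessing the map \<open>x \<mapsto> x ^ d\<close>; applied twice to \<open>a\<^sub>i\<close> it yields \<open>a\<^sub>i ^ (d * d)\<close>. Going down from
  \<open>a\<^sub>n ^ 2\<close>, the exponent is squared \<open>n\<close> times.

  On an ARAM, take \<open>A = m!\<close> with \<open>m \<rightarrow> \<infinity>\<close>. Since \<open>m!\<close> is eventually divisible by every fixed integer,
  each register is eventually a rational polynomial in \<open>m!\<close>, and this class of germs is closed under
  integer division as well. After \<open>t\<close> steps the degree is at most \<open>2 ^ t\<close> and the logarithm of the
  coefficients is \<open>2 ^ O(t\<^sup>2)\<close>. An output independent of \<open>A\<close> is a constant polynomial, hence at most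
  doubly exponential in a polynomial of \<open>n\<close>.
\<close>

section \<open>Runs of a machine and bit length\<close>

lemma run_0: "run P s xs 0 = init xs"
  by (simp add: run_def)

lemma run_Suc: "run P s xs (Suc t) = step P s (run P s xs t)"
  by (simp add: run_def)

lemma run_add: "run P s xs (t + t') = (step P s ^^ t') (run P s xs t)"
  by (simp add: run_def funpow_add add.commute[of t])

lemma run_stable:
  assumes "halted P (run P s xs t)" "t \<le> t'"
  shows "run P s xs t' = run P s xs t"
  using assms(2) by (induction rule: dec_induct) (auto simp: run_Suc step_def assms(1))

lemma bitlen_0 [simp]: "bitlen 0 = 0"
  by (simp add: bitlen_def)

lemma bitlen_pos: "0 < n \<Longrightarrow> bitlen n = Suc (bitlen (n div 2))"
proof -
  assume n: "0 < n"
  have ex: "\<exists>k. n < 2 ^ k" by (rule exI[of _ n]) simp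
  have "(LEAST k. n < 2 ^ k) = Suc (LEAST k. n < 2 ^ Suc k)"
    using ex n by (elim exE Least_Suc) auto
  moreover have "n < 2 ^ Suc k \<longleftrightarrow> n div 2 < 2 ^ k" for k
    by (simp add: div_less_iff_less_mult mult.commute)
  ultimately show ?thesis by (simp add: bitlen_def)
qed

lemma bitlen_power2: "bitlen (2 ^ n) = Suc n"
  by (induction n) (auto simp: bitlen_pos)

section \<open>Simulating an ARAM by an ASRAM\<close>

text \<open>Prepending one instruction moves the whole program by one address; \<open>Jeq\<close> is
  the only instruction that carries an address.\<close>

fun shift :: "instr \<Rightarrow> instr" where
  "shift (Jeq i j l) = Jeq i j (Suc l)"
| "shift x = x"

lemma shift_eq_Halt [simp]: "shift x = Halt \<longleftrightarrow> x = Halt"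
  by (cases x) auto

lemma exec_shift:
  assumes "\<forall>i. x \<noteq> Aln i" "exec x s (pc, R, n) = (pc', R', n')" "x \<noteq> Halt"
  shows "exec (shift x) s' (Suc pc, R, k) = (Suc pc', R', k)"
  using assms by (cases x) (auto split: if_splits)

text \<open>The second ARAM input sits in register 1, which is exactly the register filled by the
  prepended call. As \<open>r\<close> makes no calls, the call counter stays at 1.\<close>

lemma run_shift:
  assumes "no_aln r"
  shows "run (Aln (Suc 0) # map shift r) s [inp] (Suc t) =
    (case run r (\<lambda>_. 0) [inp, nat (s 0)] t of (pc, R, n) \<Rightarrow> (Suc pc, R, Suc 0))"
proof (induction t)
  case 0
  show ?case by (auto simp: run_Suc run_0 init_def step_def halted_def fun_eq_iff less_Suc_eq)
next
  case (Suc t)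
  obtain pc R n where c: "run r (\<lambda>_. 0) [inp, nat (s 0)] t = (pc, R, n)" by (metis prod_cases3)
  have l: "run (Aln (Suc 0) # map shift r) s [inp] (Suc t) = (Suc pc, R, Suc 0)" using Suc c by simp
  show ?case
  proof (cases "halted r (pc, R, n)")
    case True
    then have "halted (Aln (Suc 0) # map shift r) (Suc pc, R, Suc 0)"
      by (cases "pc < length r") (auto simp: halted_def)
    then show ?thesis
      using True by (simp add: run_Suc[of _ _ _ "Suc t"] l run_Suc[of r] c step_def)
  next
    case False
    then have pc: "pc < length r" "r ! pc \<noteq> Halt" by (auto simp: halted_def)
    then have h: "\<not> halted (Aln (Suc 0) # map shift r) (Suc pc, R, Suc 0)" by (auto simp: halted_def)
    obtain pc' R' n' where e: "exec (r ! pc) (\<lambda>_. 0) (pc, R, n) = (pc', R', n')" by (metis prod_cases3)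
    have "\<forall>i. r ! pc \<noteq> Aln i" using assms pc(1) unfolding no_aln_def by (metis nth_mem)
    from exec_shift[OF this e pc(2)]
    have "exec (shift (r ! pc)) s (Suc pc, R, Suc 0) = (Suc pc', R', Suc 0)" .
    then show ?thesis
      using False h pc e by (simp add: run_Suc[of _ _ _ "Suc t"] l run_Suc[of r] c step_def)
  qed
qed

lemma halted_shift:
  assumes "no_aln r"
  shows "halted (Aln (Suc 0) # map shift r) (run (Aln (Suc 0) # map shift r) s [inp] (Suc t)) \<longleftrightarrow>
    halted r (run r (\<lambda>_. 0) [inp, nat (s 0)] t)"
  by (cases "fst (run r (\<lambda>_. 0) [inp, nat (s 0)] t) < length r")
    (auto simp: run_shift[OF assms] halted_def split: prod.split)

lemma ARAM_imp_ASRAM: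
  assumes "ARAM_ptime f"
  shows "ASRAM_ptime f"
proof -
  obtain r c k where r: "no_aln r"
    and h: "\<And>inp A. halts_within r (\<lambda>_. 0) [inp, A] (poly_bound c k inp)"
    and o: "\<And>inp. finite {A. \<not> outputs r (\<lambda>_. 0) [inp, A] (f inp)}"
    using assms unfolding ARAM_ptime_def by blast
  define P where "P = Aln (Suc 0) # map shift r"
  have "halts_within P s [inp] (poly_bound (c + 1) k inp)" for inp s
  proof -
    obtain t where t: "t \<le> poly_bound c k inp" "halted r (run r (\<lambda>_. 0) [inp, nat (s 0)] t)"
      using h unfolding halts_within_def by blast
    \<comment> \<open>The prepended call costs one step, which the additional summand
      \<open>(bitlen inp + 1) ^ k\<close> absorbs.\<close>
    have "Suc t \<le> poly_bound (c + 1) k inp"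
    proof -
      have "1 \<le> (bitlen inp + 1) ^ k" by (rule one_le_power) simp
      then show ?thesis using t(1) unfolding poly_bound_def distrib_right by linarith
    qed
    moreover have "halted P (run P s [inp] (Suc t))"
      using t(2) halted_shift[OF r] unfolding P_def by blast
    ultimately show ?thesis unfolding halts_within_def by blast
  qed
  moreover have "\<exists>S. ALS S \<and> (\<forall>s\<in>S. outputs P s [inp] (f inp))" for inp
  proof -
    obtain B where B: "\<And>A. B < A \<Longrightarrow> outputs r (\<lambda>_. 0) [inp, A] (f inp)"
      using o[of inp] unfolding finite_nat_set_iff_bounded_le by (metis mem_Collect_eq not_le)
    \<comment> \<open>Only the first call matters: its value has to exceed all exceptional
      \<open>A\<close>. Increasing any entry preserves this.\<close>
    define S where "S = {s :: nat \<Rightarrow> int. int B < s 0}"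
    have "ALS S"
      unfolding ALS_def
    proof (intro conjI allI ballI)
      show "S \<noteq> {}" unfolding S_def by (auto intro: exI[of _ "\<lambda>_. int B + 1"])
      fix i a assume "a \<in> S"
      then have "a(i := a i + 1) \<in> S" by (auto simp: S_def)
      then show "\<exists>b\<in>S. b i = a i + 1 \<and> (\<forall>j<i. b j = a j)"
        by (intro bexI[of _ "a(i := a i + 1)"]) auto
    qed
    moreover have "outputs P s [inp] (f inp)" if "s \<in> S" for s
    proof -
      have "outputs r (\<lambda>_. 0) [inp, nat (s 0)] (f inp)" using that by (intro B) (auto simp: S_def)
      then obtain t where t: "halted r (run r (\<lambda>_. 0) [inp, nat (s 0)] t)"
        "fst (snd (run r (\<lambda>_. 0) [inp, nat (s 0)] t)) 0 = f inp"
        unfolding outputs_def by blast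
      then have "halted P (run P s [inp] (Suc t))" "fst (snd (run P s [inp] (Suc t))) 0 = f inp"
        using halted_shift[OF r, of s inp t] run_shift[OF r, of s inp t] unfolding P_def
        by (auto split: prod.splits)
      then show ?thesis unfolding outputs_def by blast
    qed
    ultimately show ?thesis by blast
  qed
  ultimately show ?thesis unfolding ASRAM_ptime_def by blast
qed

section \<open>A fast growing ASRAM function\<close>

text \<open>
  Register 2 points into the array \<open>a\<^sub>0, a\<^sub>1, \<dots>\<close>, which starts at register 10; register 5 is never
  written and supplies the constant 0. In the second loop register 0 holds \<open>a\<^sub>i\<^sub>+\<^sub>1 ^ d\<close>, register 6
  holds \<open>a\<^sub>i\<^sub>+\<^sub>1\<close> and register 7 holds \<open>a\<^sub>i\<close>.
\<close>
definition tower_prog :: prog where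
  "tower_prog = [
     Cnst 1 2, Cnst 2 10, Cnst 3 10, Cnst 4 1, St 2 1,
     Jeq 0 5 11, Dv 0 0 1, Add 2 2 4, Aln 6, St 2 6, Jeq 0 0 5,
     Ld 6 2, Mul 0 6 6,
     Jeq 2 3 26, Sub 2 2 4, Ld 7 2,
     Sub 8 6 7, Dv 9 0 8, Mul 9 9 8, Sub 8 0 9,
     Sub 8 6 8, Dv 9 0 8, Mul 9 9 8, Sub 0 0 9,
     Cpy 6 7, Jeq 0 0 13]"

section \<open>Execution of the tower program\<close>

lemma step_tower:
  assumes "pc < 26"
  shows "step tower_prog s (pc, R, n) = exec (tower_prog ! pc) s (pc, R, n)"
proof -
  have "Halt \<notin> set tower_prog" "length tower_prog = 26" by (auto simp: tower_prog_def)
  then have "\<not> halted tower_prog (pc, R, n)"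
    using assms unfolding halted_def by (metis fst_conv not_le nth_mem)
  then show ?thesis by (simp add: step_def)
qed

lemma tower_step:
  "step tower_prog s (0, R, n) = exec (Cnst (Suc 0) 2) s (0, R, n)"
  "step tower_prog s (Suc 0, R, n) = exec (Cnst 2 10) s (Suc 0, R, n)"
  "step tower_prog s (2, R, n) = exec (Cnst 3 10) s (2, R, n)"
  "step tower_prog s (Suc (Suc 0), R, n) = exec (Cnst 3 10) s (2, R, n)"
  "step tower_prog s (3, R, n) = exec (Cnst 4 (Suc 0)) s (3, R, n)"
  "step tower_prog s (4, R, n) = exec (St 2 (Suc 0)) s (4, R, n)"
  "step tower_prog s (5, R, n) = exec (Jeq 0 5 11) s (5, R, n)"
  "step tower_prog s (6, R, n) = exec (Dv 0 0 (Suc 0)) s (6, R, n)"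
  "step tower_prog s (7, R, n) = exec (Add 2 2 4) s (7, R, n)"
  "step tower_prog s (8, R, n) = exec (Aln 6) s (8, R, n)"
  "step tower_prog s (9, R, n) = exec (St 2 6) s (9, R, n)"
  "step tower_prog s (10, R, n) = exec (Jeq 0 0 5) s (10, R, n)"
  "step tower_prog s (11, R, n) = exec (Ld 6 2) s (11, R, n)"
  "step tower_prog s (12, R, n) = exec (Mul 0 6 6) s (12, R, n)"
  "step tower_prog s (13, R, n) = exec (Jeq 2 3 26) s (13, R, n)"
  "step tower_prog s (14, R, n) = exec (Sub 2 2 4) s (14, R, n)"
  "step tower_prog s (15, R, n) = exec (Ld 7 2) s (15, R, n)"
  "step tower_prog s (16, R, n) = exec (Sub 8 6 7) s (16, R, n)"
  "step tower_prog s (17, R, n) = exec (Dv 9 0 8) s (17, R, n)"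
  "step tower_prog s (18, R, n) = exec (Mul 9 9 8) s (18, R, n)"
  "step tower_prog s (19, R, n) = exec (Sub 8 0 9) s (19, R, n)"
  "step tower_prog s (20, R, n) = exec (Sub 8 6 8) s (20, R, n)"
  "step tower_prog s (21, R, n) = exec (Dv 9 0 8) s (21, R, n)"
  "step tower_prog s (22, R, n) = exec (Mul 9 9 8) s (22, R, n)"
  "step tower_prog s (23, R, n) = exec (Sub 0 0 9) s (23, R, n)"
  "step tower_prog s (24, R, n) = exec (Cpy 6 7) s (24, R, n)"
  "step tower_prog s (25, R, n) = exec (Jeq 0 0 13) s (25, R, n)"
  by (simp_all add: step_tower) (simp_all add: tower_prog_def)

fun aln_val :: "(nat \<Rightarrow> int) \<Rightarrow> nat \<Rightarrow> nat" where
  "aln_val s 0 = 2"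
| "aln_val s (Suc i) = nat (s i)"

text \<open>The arithmetic of the second loop, detached from memory. If
  \<open>W = a (Suc i) ^ d\<close>, the inner remainder is meant to be \<open>a i ^ d\<close> and
  the outer one \<open>(a i ^ d) ^ d\<close>. Truncated subtraction and \<open>mod 0\<close> keep it
  meaningful for arbitrary ALN values.\<close>

primrec descend :: "(nat \<Rightarrow> nat) \<Rightarrow> nat \<Rightarrow> nat \<Rightarrow> nat" where
  "descend a 0 W = W"
| "descend a (Suc i) W = descend a i (W mod (a (Suc i) - W mod (a (Suc i) - a i)))"

lemma tower_iter1:
  assumes "R 0 \<noteq> 0" "R 5 = 0" "R 1 = 2" "R 4 = 1" "10 \<le> R 2"
  shows "(step tower_prog s ^^ 6) (5, R, n) =
    (5, R(0 := R 0 div 2, 2 := Suc (R 2), 6 := nat (s n), Suc (R 2) := nat (s n)), Suc n)"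
proof -
  have "(step tower_prog s ^^ Suc (Suc (Suc (Suc (Suc (Suc 0)))))) (5, R, n) =
    (5, R(0 := R 0 div 2, 2 := Suc (R 2), 6 := nat (s n), Suc (R 2) := nat (s n)), Suc n)"
    using assms by (simp add: funpow_swap1 tower_step)
  then show ?thesis by (simp add: numeral_eq_Suc)
qed

text \<open>Each round of 6 steps halves register 0 and appends one ALN value, so there are
  \<open>bitlen (R 0)\<close> rounds whatever values are returned; the last zero test adds one
  step.\<close>

lemma tower_loop1:
  assumes "R 5 = 0" "R 1 = 2" "R 4 = 1" "R 2 = 10 + n" "R 3 = 10"
    "\<forall>i\<le>n. R (10 + i) = aln_val s i"
  shows "\<exists>R'. (step tower_prog s ^^ (6 * bitlen (R 0) + 1)) (5, R, n) = (11, R', n + bitlen (R 0)) \<and>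
    R' 4 = 1 \<and> R' 2 = 10 + (n + bitlen (R 0)) \<and> R' 3 = 10 \<and>
    (\<forall>i\<le>n + bitlen (R 0). R' (10 + i) = aln_val s i)"
  using assms
proof (induction "R 0" arbitrary: R n rule: less_induct)
  case less
  show ?case
  proof (cases "R 0 = 0")
    case True
    then show ?thesis using less.prems by (auto simp: tower_step)
  next
    case False
    define R' where "R' = R(0 := R 0 div 2, 2 := Suc (R 2), 6 := nat (s n), Suc (R 2) := nat (s n))"
    have it: "(step tower_prog s ^^ 6) (5, R, n) = (5, R', Suc n)"
      unfolding R'_def using False less.prems by (intro tower_iter1) auto
    have R0: "R' 0 = R 0 div 2" using less.prems by (simp add: R'_def)
    have b: "bitlen (R 0) = Suc (bitlen (R' 0))" using False by (simp add: R0 bitlen_pos)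
    have "R' 0 < R 0" using False R0 by simp
    moreover have "R' 5 = 0" "R' 1 = 2" "R' 4 = 1" "R' 2 = 10 + Suc n" "R' 3 = 10"
      using less.prems by (auto simp: R'_def)
    moreover have "\<forall>i\<le>Suc n. R' (10 + i) = aln_val s i"
      using less.prems by (auto simp: R'_def le_Suc_eq)
    ultimately obtain R'' where
      "(step tower_prog s ^^ (6 * bitlen (R' 0) + 1)) (5, R', Suc n) = (11, R'', Suc n + bitlen (R' 0))"
      "R'' 4 = 1 \<and> R'' 2 = 10 + (Suc n + bitlen (R' 0)) \<and> R'' 3 = 10 \<and>
       (\<forall>i\<le>Suc n + bitlen (R' 0). R'' (10 + i) = aln_val s i)"
      using less.hyps[of R' "Suc n"] by blast
    moreover have "6 * bitlen (R 0) + 1 = (6 * bitlen (R' 0) + 1) + 6" using b by simp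
    then have "(step tower_prog s ^^ (6 * bitlen (R 0) + 1)) (5, R, n) =
        (step tower_prog s ^^ (6 * bitlen (R' 0) + 1)) (5, R', Suc n)"
      by (simp only: funpow_add o_apply it)
    moreover have "Suc n + bitlen (R' 0) = n + bitlen (R 0)" using b by simp
    ultimately show ?thesis by metis
  qed
qed

text \<open>Remainders are computed as \<open>w - w div m * m\<close>. This equals
  \<open>w mod m\<close> for \<open>m = 0\<close> too, so a round is described correctly for every
  ALN sequence.\<close>

lemma tower_iter2:
  assumes "R 3 = 10" "R 2 = Suc p" "10 \<le> p" "R 4 = 1"
  shows "\<exists>R'. (step tower_prog s ^^ 13) (13, R, n) = (13, R', n) \<and>
    R' 0 = R 0 mod (R 6 - R 0 mod (R 6 - R p)) \<and> R' 2 = p \<and> R' 3 = 10 \<and> R' 4 = 1 \<and>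
    R' 6 = R p \<and> (\<forall>i\<ge>10. R' i = R i)"
proof -
  define y where "y = R 0 mod (R 6 - R p)"
  define R1 where "R1 = R(2 := p, 7 := R p, 8 := y, 9 := R 0 div (R 6 - R p) * (R 6 - R p))"
  have "(step tower_prog s ^^ Suc (Suc (Suc (Suc (Suc (Suc (Suc 0))))))) (13, R, n) = (20, R1, n)"
    using assms by (simp add: tower_step R1_def y_def minus_div_mult_eq_mod funpow_swap1 fun_eq_iff)
  then have 1: "(step tower_prog s ^^ 7) (13, R, n) = (20, R1, n)" by (simp add: numeral_eq_Suc)
  define R2 where "R2 = R1(8 := R 6 - y, 9 := R 0 div (R 6 - y) * (R 6 - y), 0 := R 0 mod (R 6 - y), 6 := R p)"
  have "(step tower_prog s ^^ Suc (Suc (Suc (Suc (Suc (Suc 0)))))) (20, R1, n) = (13, R2, n)"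
    by (simp add: tower_step R1_def R2_def minus_div_mult_eq_mod funpow_swap1 fun_eq_iff)
  then have 2: "(step tower_prog s ^^ 6) (20, R1, n) = (13, R2, n)" by (simp add: numeral_eq_Suc)
  have "(step tower_prog s ^^ (6 + 7)) (13, R, n) = (13, R2, n)"
    by (simp only: funpow_add o_apply 1 2)
  then have "(step tower_prog s ^^ 13) (13, R, n) = (13, R2, n)" by simp
  then show ?thesis using assms by (auto simp: R2_def R1_def y_def)
qed

lemma tower_loop2:
  assumes "R 3 = 10" "R 2 = 10 + i" "R 4 = 1" "R 6 = R (10 + i)"
    "\<forall>j\<le>i. R (10 + j) = a j"
  shows "\<exists>R'. (step tower_prog s ^^ (13 * i + 1)) (13, R, n) = (26, R', n) \<and> R' 0 = descend a i (R 0)"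
  using assms
proof (induction i arbitrary: R)
  case 0
  then show ?case by (simp add: tower_step)
next
  case (Suc i)
  obtain R' where it: "(step tower_prog s ^^ 13) (13, R, n) = (13, R', n)"
    and R': "R' 0 = R 0 mod (R 6 - R 0 mod (R 6 - R (10 + i)))" "R' 2 = 10 + i" "R' 3 = 10" "R' 4 = 1"
      "R' 6 = R (10 + i)" "\<forall>j\<ge>10. R' j = R j"
    using tower_iter2[of R "10 + i" s n] Suc.prems by auto
  have "R' 6 = R' (10 + i)" "\<forall>j\<le>i. R' (10 + j) = a j" using R' Suc.prems by auto
  then obtain R'' where "(step tower_prog s ^^ (13 * i + 1)) (13, R', n) = (26, R'', n)"
    "R'' 0 = descend a i (R' 0)"
    using Suc.IH[of R'] R' by blast
  moreover have "13 * Suc i + 1 = (13 * i + 1) + 13" by simp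
  then have "(step tower_prog s ^^ (13 * Suc i + 1)) (13, R, n) =
      (step tower_prog s ^^ (13 * i + 1)) (13, R', n)"
    by (simp only: funpow_add o_apply it)
  moreover have "R (10 + i) = a i" "R 6 = a (Suc i)" using Suc.prems by auto
  ultimately show ?case using R'(1) by (simp del: funpow.simps)
qed

text \<open>The step count is independent of \<open>s\<close>, which yields the worst-case running
  time: 5 steps of setup, \<open>6 * b + 1\<close> for filling the array, 2 for squaring its top
  entry, \<open>13 * b + 1\<close> for the descent.\<close>

lemma run_tower_prog:
  "\<exists>R n. run tower_prog s [inp] (19 * bitlen inp + 9) = (26, R, n) \<and>
    R 0 = descend (aln_val s) (bitlen inp) ((aln_val s (bitlen inp))\<^sup>2)"
proof -
  define b where "b = bitlen inp"
  define R0 where "R0 = (\<lambda>i::nat. 0)(0 := inp, 1 := 2, 2 := 10, 3 := 10, 4 := 1, 10 := 2::nat)"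
  have "run tower_prog s [inp] (Suc (Suc (Suc (Suc (Suc 0))))) = (5, R0, 0)"
    by (simp add: run_Suc run_0 init_def tower_step R0_def fun_eq_iff)
  then have 1: "run tower_prog s [inp] 5 = (5, R0, 0)" by (simp add: numeral_eq_Suc)
  obtain R1 where 2: "(step tower_prog s ^^ (6 * b + 1)) (5, R0, 0) = (11, R1, b)"
    and R1: "R1 4 = 1" "R1 2 = 10 + b" "R1 3 = 10" "\<forall>i\<le>b. R1 (10 + i) = aln_val s i"
    using tower_loop1[of R0 0 s] by (auto simp: R0_def b_def)
  define R2 where "R2 = R1(6 := R1 (R1 2), 0 := (R1 (R1 2))\<^sup>2)"
  have "(step tower_prog s ^^ Suc (Suc 0)) (11, R1, b) = (13, R2, b)"
    using R1 by (simp add: tower_step R2_def power2_eq_square)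
  then have 3: "(step tower_prog s ^^ 2) (11, R1, b) = (13, R2, b)" by (simp add: numeral_eq_Suc)
  have "R2 3 = 10" "R2 2 = 10 + b" "R2 4 = 1" "R2 6 = R2 (10 + b)" "\<forall>j\<le>b. R2 (10 + j) = aln_val s j"
    using R1 by (auto simp: R2_def)
  from tower_loop2[OF this, of s b] obtain R3 where
    4: "(step tower_prog s ^^ (13 * b + 1)) (13, R2, b) = (26, R3, b)" and
    R3: "R3 0 = descend (aln_val s) b (R2 0)" by blast
  have "19 * b + 9 = 5 + (6 * b + 1) + 2 + (13 * b + 1)" by simp
  then have "run tower_prog s [inp] (19 * b + 9) = (26, R3, b)"
    by (simp only: run_add 1 2 3 4)
  moreover have "R2 0 = (aln_val s b)\<^sup>2" using R1 by (simp add: R2_def)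
  ultimately show ?thesis using R3 unfolding b_def by auto
qed

section \<open>Remainders of powers of large numbers\<close>

lemma power_mod_diff:
  fixes x y d :: nat
  assumes "x + x ^ d < y"
  shows "y ^ d mod (y - x) = x ^ d"
proof -
  have "y mod (y - x) = x mod (y - x)"
    using assms by (metis add_leD1 le_add_diff_inverse less_imp_le mod_add_self2)
  then have "y ^ d mod (y - x) = x ^ d mod (y - x)" by (metis power_mod)
  also have "\<dots> = x ^ d" using assms by simp
  finally show ?thesis .
qed

text \<open>Each level squares the exponent, that is, doubles the exponent of 2 in it; from exponent
  2 at level \<open>n\<close> this leads to \<open>2 ^ 2 ^ n\<close> at the base
  \<open>a 0 = 2\<close>.\<close>

lemma descend_eq:
  assumes "\<And>i. 2 \<le> a i" "a 0 = 2" "\<And>i. 2 * a i ^ (2 ^ 2 ^ n) < a (Suc i)" "i \<le> n"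
  shows "descend a i (a i ^ (2 ^ 2 ^ (n - i))) = 2 ^ 2 ^ 2 ^ n"
  using assms(4)
proof (induction i)
  case 0
  then show ?case using assms(2) by simp
next
  case (Suc i)
  define d :: nat where "d = 2 ^ 2 ^ (n - Suc i)"
  define x where "x = a i"
  have "d * d = 2 ^ (2 ^ (n - Suc i) * 2)" by (simp add: d_def power2_eq_square power_mult)
  also have "2 ^ (n - Suc i) * 2 = (2 ^ (n - i) :: nat)"
    using Suc.prems by (metis Suc_diff_Suc Suc_le_lessD power_Suc2)
  finally have dd: "d * d = 2 ^ 2 ^ (n - i)" .
  have dn: "d * d \<le> 2 ^ 2 ^ n" unfolding dd by (intro power_increasing) auto
  have d1: "1 \<le> d" by (simp add: d_def)
  have x: "2 \<le> x" using assms(1) by (simp add: x_def)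
  \<comment> \<open>All powers of \<open>x\<close> that occur have exponent at most
    \<open>d * d\<close>. The factor 2 in the growth hypothesis therefore covers both sums,
    \<open>x + x ^ d\<close> and \<open>x ^ d + (x ^ d) ^ d\<close>.\<close>
  have le: "x ^ e \<le> x ^ (2 ^ 2 ^ n)" if "e \<le> d * d" for e
    using x dn that by (intro power_increasing) auto
  have ge: "1 \<le> d * d" "d \<le> d * d" using d1 by auto
  have big: "2 * x ^ (2 ^ 2 ^ n) < a (Suc i)" using assms(3) by (simp add: x_def)
  have 1: "a (Suc i) ^ d mod (a (Suc i) - x) = x ^ d"
    using le[OF ge(1)] le[OF ge(2)] big by (intro power_mod_diff) auto
  have 2: "a (Suc i) ^ d mod (a (Suc i) - x ^ d) = (x ^ d) ^ d"
    using le[OF ge(2)] le[OF order_refl] big by (intro power_mod_diff) (auto simp: power_mult)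
  have "descend a (Suc i) (a (Suc i) ^ d) = descend a i (x ^ (d * d))"
    using 1 2 by (simp add: x_def power_mult)
  also have "\<dots> = 2 ^ 2 ^ 2 ^ n" using Suc unfolding dd x_def by simp
  finally show ?case by (simp add: d_def)
qed

section \<open>An ALS set of fast growing sequences\<close>

definition fast_seqs :: "nat \<Rightarrow> (nat \<Rightarrow> int) set" where
  "fast_seqs D = {s. \<forall>i. int (2 * aln_val s i ^ D) < s i}"

text \<open>Increasing one entry may break the growth condition at later entries. Here the entries
  up to index \<open>k\<close> are kept and the later ones rebuilt with the least admissible
  values.\<close>

primrec fast_extend :: "nat \<Rightarrow> nat \<Rightarrow> (nat \<Rightarrow> int) \<Rightarrow> nat \<Rightarrow> int" where
  "fast_extend D k a 0 = a 0"
| "fast_extend D k a (Suc i) =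
     (if i < k then a (Suc i) else 2 * int (nat (fast_extend D k a i)) ^ D + 1)"

lemma fast_extend_eq: "i \<le> k \<Longrightarrow> fast_extend D k a i = a i"
  by (cases i) auto

lemma fast_extend_in_fast_seqs:
  assumes "\<And>i. i \<le> k \<Longrightarrow> int (2 * aln_val a i ^ D) < a i"
  shows "fast_extend D k a \<in> fast_seqs D"
  unfolding fast_seqs_def
proof (intro CollectI allI)
  fix i
  show "int (2 * aln_val (fast_extend D k a) i ^ D) < fast_extend D k a i"
  proof (cases "i \<le> k")
    case True
    then have "aln_val (fast_extend D k a) i = aln_val a i"
      by (cases i) (auto simp: fast_extend_eq)
    then show ?thesis using assms[OF True] True by (simp add: fast_extend_eq)
  next
    case False
    then show ?thesis by (cases i) auto
  qed
qed

lemma ALS_fast_seqs: "ALS (fast_seqs D)"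
  unfolding ALS_def
proof (intro conjI allI ballI)
  \<comment> \<open>Only entry 0 is kept; it is compared with
    \<open>aln_val a 0 = 2\<close>.\<close>
  have "fast_extend D 0 (\<lambda>_. 2 * 2 ^ D + 1) \<in> fast_seqs D"
    by (intro fast_extend_in_fast_seqs) auto
  then show "fast_seqs D \<noteq> {}" by blast
next
  fix i a assume a: "a \<in> fast_seqs D"
  define a' where "a' = a(i := a i + 1)"
  have "int (2 * aln_val a' j ^ D) < a' j" if "j \<le> i" for j
  proof -
    have "aln_val a' j = aln_val a j" using that by (cases j) (auto simp: a'_def)
    moreover have "int (2 * aln_val a j ^ D) < a j" using a unfolding fast_seqs_def by blast
    ultimately show ?thesis by (auto simp: a'_def)
  qed
  then have "fast_extend D i a' \<in> fast_seqs D" by (rule fast_extend_in_fast_seqs)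
  then show "\<exists>b\<in>fast_seqs D. b i = a i + 1 \<and> (\<forall>j<i. b j = a j)"
    by (intro bexI[of _ "fast_extend D i a'"]) (auto simp: fast_extend_eq a'_def)
qed

lemma halted_tower_prog: "halted tower_prog (26, R, n)"
  by (simp add: halted_def tower_prog_def)

lemma ASRAM_triple_exp: "ASRAM_ptime (\<lambda>inp. 2 ^ 2 ^ 2 ^ bitlen inp)"
  unfolding ASRAM_ptime_def
proof (rule exI[of _ tower_prog], rule exI[of _ 19], rule exI[of _ 1], intro conjI allI)
  show "halts_within tower_prog s [inp] (poly_bound 19 1 inp)" for inp s
    using run_tower_prog[of s inp] halted_tower_prog unfolding halts_within_def poly_bound_def
    by (intro exI[of _ "19 * bitlen inp + 9"]) auto
next
  fix inp
  define n where "n = bitlen inp"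
  \<comment> \<open>The ALS set may depend on the input, so the growth rate can be the largest
    exponent reached in the descent.\<close>
  define D :: nat where "D = 2 ^ 2 ^ n"
  have "outputs tower_prog s [inp] (2 ^ 2 ^ 2 ^ bitlen inp)" if s: "s \<in> fast_seqs D" for s
  proof -
    have grow: "2 * aln_val s i ^ D < aln_val s (Suc i)" for i
      using s unfolding fast_seqs_def by (auto simp: zless_nat_eq_int_zless)
    have two: "2 \<le> aln_val s i" for i
    proof (induction i)
      case (Suc i)
      then have "1 \<le> aln_val s i ^ D" by (intro one_le_power) simp
      then show ?case using grow[of i] by linarith
    qed simp
    have "descend (aln_val s) n (aln_val s n ^ (2 ^ 2 ^ (n - n))) = 2 ^ 2 ^ 2 ^ n"
      using two grow unfolding D_def by (intro descend_eq) auto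
    then show ?thesis
      using run_tower_prog[of s inp] halted_tower_prog unfolding outputs_def n_def
      by (intro exI[of _ "19 * bitlen inp + 9"]) auto
  qed
  then show "\<exists>S. ALS S \<and> (\<forall>s\<in>S. outputs tower_prog s [inp] (2 ^ 2 ^ 2 ^ bitlen inp))"
    using ALS_fast_seqs by blast
qed

section \<open>Germs of rational polynomials along the factorials\<close>

definition l1 :: "int poly \<Rightarrow> int" where
  "l1 p = (\<Sum>c\<leftarrow>coeffs p. \<bar>c\<bar>)"

lemma l1_0 [simp]: "l1 0 = 0"
  by (simp add: l1_def)

lemma l1_pCons [simp]: "l1 (pCons a p) = \<bar>a\<bar> + l1 p"
  by (cases "a = 0 \<and> p = 0") (auto simp: l1_def cCons_def)

lemma l1_nonneg [simp]: "0 \<le> l1 p"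
  by (induction p) auto

lemma l1_add: "l1 (p + q) \<le> l1 p + l1 q"
  by (induction p q rule: poly_induct2) auto

lemma l1_smult [simp]: "l1 (smult c p) = \<bar>c\<bar> * l1 p"
  by (induction p) (auto simp: abs_mult algebra_simps)

lemma l1_minus [simp]: "l1 (- p) = l1 p"
  by (induction p) auto

lemma l1_diff: "l1 (p - q) \<le> l1 p + l1 q"
  using l1_add[of p "- q"] by simp

text \<open>With \<open>l1_add\<close>, this lets coefficient bounds pass through arithmetic without
  a factor for the number of terms.\<close>

lemma l1_mult: "l1 (p * q) \<le> l1 p * l1 q"
proof (induction p)
  case (pCons a p)
  have "l1 (pCons a p * q) \<le> l1 (smult a q) + l1 (pCons 0 (p * q))"
    by (metis l1_add mult_pCons_left)
  then show ?case using pCons by (auto simp: algebra_simps)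
qed simp

lemma l1_monom [simp]: "l1 (monom c k) = \<bar>c\<bar>"
  by (induction k) (auto simp: monom_0 monom_Suc)

lemma abs_coeff_le_l1: "\<bar>coeff p i\<bar> \<le> l1 p"
proof (induction p arbitrary: i)
  case (pCons a p)
  show ?case
  proof (cases i)
    case (Suc j)
    then show ?thesis using pCons.IH[of j] by simp
  qed simp
qed simp

text \<open>Scaling by the leading coefficient replaces division by it, so all polynomials stay
  integral. Each round removes one top coefficient. Vanishing coefficients are used instead of
  degrees so that a constant \<open>M\<close> forces \<open>R = 0\<close>.\<close>

lemma pseudo_division:
  fixes N M :: "int poly"
  assumes "l1 M \<le> b" "1 \<le> b" "\<forall>i\<ge>k + degree M. coeff N i = 0" "l1 N \<le> a"
  shows "\<exists>Q R. smult (lead_coeff M ^ k) N = Q * M + R \<and> (\<forall>i\<ge>degree M. coeff R i = 0) \<and>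
    (\<forall>i\<ge>k. coeff Q i = 0) \<and> l1 Q \<le> a * (4 * b) ^ k"
  using assms(3,4)
proof (induction k arbitrary: N a)
  case 0
  have "0 \<le> a" using 0 l1_nonneg[of N] by linarith
  then show ?case using 0 by (intro exI[of _ 0] exI[of _ N]) auto
next
  case (Suc k)
  define l where "l = lead_coeff M"
  define c where "c = coeff N (k + degree M)"
  define N' where "N' = smult l N - monom c k * M"
  have a0: "0 \<le> a" using Suc l1_nonneg[of N] by linarith
  have l: "\<bar>l\<bar> \<le> b" unfolding l_def using abs_coeff_le_l1[of M "degree M"] assms(1) by linarith
  have c: "\<bar>c\<bar> \<le> a" unfolding c_def using abs_coeff_le_l1[of N] Suc.prems(2) order_trans by blast
  have z: "\<forall>i\<ge>k + degree M. coeff N' i = 0"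
  proof (intro allI impI)
    fix i assume i: "k + degree M \<le> i"
    show "coeff N' i = 0"
    proof (cases "i = k + degree M")
      case True
      then show ?thesis by (simp add: N'_def coeff_monom_mult l_def c_def)
    next
      case False
      then have "coeff N i = 0" "coeff M (i - k) = 0"
        using i Suc.prems(1) by (auto intro: coeff_eq_0)
      then show ?thesis using i by (simp add: N'_def coeff_monom_mult)
    qed
  qed
  have n: "l1 N' \<le> 2 * a * b"
  proof -
    have "l1 N' \<le> \<bar>l\<bar> * l1 N + \<bar>c\<bar> * l1 M"
      unfolding N'_def using l1_diff[of "smult l N" "monom c k * M"] l1_mult[of "monom c k" M] by simp
    also have "\<dots> \<le> b * a + a * b"
      using l c assms(1,2) Suc.prems(2) a0 by (intro add_mono mult_mono) auto
    finally show ?thesis by simp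
  qed
  obtain Q R where QR: "smult (l ^ k) N' = Q * M + R" "\<forall>i\<ge>degree M. coeff R i = 0"
    "\<forall>i\<ge>k. coeff Q i = 0" "l1 Q \<le> 2 * a * b * (4 * b) ^ k"
    using Suc.IH[OF z n] unfolding l_def by blast
  have "smult (l ^ Suc k) N = smult (l ^ k) (N' + monom c k * M)"
    by (simp add: N'_def mult.commute)
  also have "\<dots> = (Q + smult (l ^ k) (monom c k)) * M + R"
    by (simp add: QR(1) smult_add_right distrib_right)
  also have "smult (l ^ k) (monom c k) = monom (l ^ k * c) k"
    by (simp add: smult_monom)
  finally have e: "smult (l ^ Suc k) N = (Q + monom (l ^ k * c) k) * M + R" .
  have "\<bar>l ^ k * c\<bar> \<le> b ^ k * a"
    using l c a0 assms(2) by (auto simp: abs_mult power_abs intro!: mult_mono power_mono)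
  \<comment> \<open>The bound \<open>a * (4 * b) ^ Suc k\<close> splits into two equal halves, one
    for \<open>Q\<close> and one for the new monomial.\<close>
  also have "\<dots> \<le> (4 * b) ^ k * (a * (2 * b))"
    using a0 assms(2) by (intro mult_mono power_mono) (auto simp: mult_le_cancel_left1)
  finally have "l1 (Q + monom (l ^ k * c) k) \<le> a * (4 * b) ^ Suc k"
    using l1_add[of Q "monom (l ^ k * c) k"] QR(4) by (simp add: algebra_simps)
  moreover have "\<forall>i\<ge>Suc k. coeff (Q + monom (l ^ k * c) k) i = 0"
    using QR(3) by simp
  ultimately show ?case using e QR(2) unfolding l_def by blast
qed

section \<open>Signs and comparison along the factorials\<close>

lemma eventually_poly_fact_pos:
  fixes p :: "int poly"
  assumes "0 < lead_coeff p"
  shows "\<forall>\<^sub>F m in sequentially. 0 < poly p (fact m)"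
proof -
  have "\<exists>n. \<forall>x\<ge>n. 0 < poly p x" using assms
  proof (induction p)
    case (pCons a p)
    show ?case
    proof (cases "p = 0")
      case True
      then show ?thesis using pCons by auto
    next
      case False
      then obtain n where n: "\<forall>x\<ge>n. 0 < poly p x" using pCons by auto
      have "0 < poly (pCons a p) x" if "x \<ge> max n (\<bar>a\<bar> + 1)" for x
      proof -
        \<comment> \<open>A positive integer value is at least 1, so in
          \<open>a + x * poly p x\<close> the second summand outweighs \<open>a\<close> once
          \<open>x\<close> exceeds its absolute value.\<close>
        have "x * 1 \<le> x * poly p x" using n that by (intro mult_left_mono) force+
        then show ?thesis using that by (simp; linarith)
      qed
      then show ?thesis by blast
    qed
  qed simp
  then obtain n where n: "\<forall>x\<ge>n. 0 < poly p x" ..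
  have "n \<le> fact m" if "nat n \<le> m" for m
    using fact_ge_self[of m] that by (metis nat_le_iff of_nat_fact order_trans)
  then show ?thesis using n by (auto simp: eventually_sequentially intro!: exI[of _ "nat n"])
qed

lemma poly_fact_sign_cases:
  fixes p :: "int poly"
  obtains "\<forall>\<^sub>F m in sequentially. 0 < poly p (fact m)" | "p = 0"
  | "\<forall>\<^sub>F m in sequentially. poly p (fact m) < 0"
proof -
  consider "0 < lead_coeff p" | "p = 0" | "0 < lead_coeff (- p)"
    by (metis lead_coeff_minus leading_coeff_0_iff linorder_neqE_linordered_idom neg_0_less_iff_less)
  then show ?thesis
    using that eventually_poly_fact_pos[of p] eventually_poly_fact_pos[of "- p"] by cases auto
qed

text \<open>
  The function \<open>g\<close> is eventually \<open>N(m!) / q\<close>; the parameter \<open>H\<close> bounds both the denominator and the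
  coefficients. Integrality of the constant term of \<open>N / q\<close> need not be recorded, because \<open>q\<close>
  eventually divides \<open>m!\<close>.
\<close>
definition bounded_germ :: "nat \<Rightarrow> int \<Rightarrow> (nat \<Rightarrow> nat) \<Rightarrow> bool" where
  "bounded_germ D H g \<longleftrightarrow> (\<exists>N q. 0 < q \<and> q \<le> H \<and> l1 N \<le> H \<and> degree N \<le> D \<and>
     (\<forall>\<^sub>F m in sequentially. q * int (g m) = poly N (fact m)))"

definition germ :: "(nat \<Rightarrow> nat) \<Rightarrow> bool" where
  "germ g \<longleftrightarrow> (\<exists>D H. bounded_germ D H g)"

lemma bounded_germI:
  assumes "0 < q" "q \<le> H" "l1 N \<le> H" "degree N \<le> D"
    "\<forall>\<^sub>F m in sequentially. q * int (g m) = poly N (fact m)"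
  shows "bounded_germ D H g"
  using assms unfolding bounded_germ_def by blast

lemma bounded_germE:
  assumes "bounded_germ D H g"
  obtains N q where "0 < q" "q \<le> H" "l1 N \<le> H" "degree N \<le> D"
    "\<forall>\<^sub>F m in sequentially. q * int (g m) = poly N (fact m)"
  using assms unfolding bounded_germ_def by blast

lemma bounded_germ_imp_germ: "bounded_germ D H g \<Longrightarrow> germ g"
  unfolding germ_def by blast

lemma bounded_germ_mono:
  "bounded_germ D H g \<Longrightarrow> D \<le> D' \<Longrightarrow> H \<le> H' \<Longrightarrow> bounded_germ D' H' g"
  unfolding bounded_germ_def by (meson order_trans)

lemma bounded_germ_cong:
  assumes "bounded_germ D H g" "\<forall>\<^sub>F m in sequentially. g m = g' m"
  shows "bounded_germ D H g'"
proof -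
  obtain N q where *: "0 < q" "q \<le> H" "l1 N \<le> H" "degree N \<le> D"
    and g: "\<forall>\<^sub>F m in sequentially. q * int (g m) = poly N (fact m)"
    using assms(1) by (rule bounded_germE)
  from g assms(2) have "\<forall>\<^sub>F m in sequentially. q * int (g' m) = poly N (fact m)"
    by eventually_elim simp
  with * show ?thesis by (rule bounded_germI)
qed

lemma bounded_germ_const: "1 \<le> H \<Longrightarrow> int c \<le> H \<Longrightarrow> bounded_germ D H (\<lambda>_. c)"
  by (rule bounded_germI[of 1 _ "[:int c:]"]) auto

lemma germ_const: "germ (\<lambda>_. c)"
  using bounded_germ_const[of "int c + 1" c 0] by (auto intro: bounded_germ_imp_germ)

lemma bounded_germ_fact: "1 \<le> H \<Longrightarrow> 1 \<le> D \<Longrightarrow> bounded_germ D H fact"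
  by (rule bounded_germI[of 1 _ "[:0, 1:]"]) auto

lemma bounded_germ_ge_1: "bounded_germ D H g \<Longrightarrow> 1 \<le> H"
  by (auto elim: bounded_germE)

text \<open>Cross-multiplication reduces the comparison to the eventual sign of one polynomial. This
  decides branches, truncated subtraction and coincidence of addresses.\<close>

lemma germ_cases:
  assumes "germ g" "germ h"
  obtains "\<forall>\<^sub>F m in sequentially. g m < h m" | "\<forall>\<^sub>F m in sequentially. g m = h m"
  | "\<forall>\<^sub>F m in sequentially. h m < g m"
proof -
  obtain N q where q: "0 < q"
    and g: "\<forall>\<^sub>F m in sequentially. q * int (g m) = poly N (fact m)"
    using assms(1) unfolding germ_def by (auto elim: bounded_germE)
  obtain M r where r: "0 < r"
    and h: "\<forall>\<^sub>F m in sequentially. r * int (h m) = poly M (fact m)"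
    using assms(2) unfolding germ_def by (auto elim: bounded_germE)
  define p where "p = smult r N - smult q M"
  have p: "\<forall>\<^sub>F m in sequentially. poly p (fact m) = q * r * (int (g m) - int (h m))"
    using g h unfolding p_def
  proof eventually_elim
    case (elim m)
    show ?case by (simp add: algebra_simps flip: elim)
  qed
  have qr: "0 < q * r" using q r by simp
  show ?thesis
  proof (cases p rule: poly_fact_sign_cases)
    case 1
    with p have "\<forall>\<^sub>F m in sequentially. h m < g m"
      by eventually_elim (use qr in \<open>simp add: zero_less_mult_iff[of "q * r"]\<close>)
    then show ?thesis by (rule that(3))
  next
    case 2
    from p have "\<forall>\<^sub>F m in sequentially. g m = h m"
      by eventually_elim (use q r 2 in simp)
    then show ?thesis by (rule that(2))
  next
    case 3
    with p have "\<forall>\<^sub>F m in sequentially. g m < h m"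
      by eventually_elim (use qr in \<open>simp add: mult_less_0_iff[of "q * r"]\<close>)
    then show ?thesis by (rule that(1))
  qed
qed

section \<open>Closure of germs under the machine arithmetic\<close>

lemma bounded_germ_add:
  assumes "bounded_germ D H g" "bounded_germ D H h"
  shows "bounded_germ D (2 * H\<^sup>2) (\<lambda>m. g m + h m)"
proof -
  obtain N q where N: "0 < q" "q \<le> H" "l1 N \<le> H" "degree N \<le> D"
    and g: "\<forall>\<^sub>F m in sequentially. q * int (g m) = poly N (fact m)"
    using assms(1) by (rule bounded_germE)
  obtain M r where M: "0 < r" "r \<le> H" "l1 M \<le> H" "degree M \<le> D"
    and h: "\<forall>\<^sub>F m in sequentially. r * int (h m) = poly M (fact m)"
    using assms(2) by (rule bounded_germE)
  have "q * r \<le> H * H" "r * l1 N \<le> H * H" "q * l1 M \<le> H * H"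
    using N M by (auto intro!: mult_mono)
  moreover have "l1 (smult r N + smult q M) \<le> r * l1 N + q * l1 M"
    using l1_add[of "smult r N" "smult q M"] N M by simp
  moreover have "0 \<le> H * H" by simp
  ultimately have *: "q * r \<le> 2 * H\<^sup>2" "l1 (smult r N + smult q M) \<le> 2 * H\<^sup>2"
    unfolding power2_eq_square by linarith+
  have "\<forall>\<^sub>F m in sequentially.
      q * r * int (g m + h m) = poly (smult r N + smult q M) (fact m)"
    using g h
  proof eventually_elim
    case (elim m)
    show ?case by (simp add: algebra_simps flip: elim)
  qed
  then show ?thesis
    using N M * by (intro bounded_germI[of "q * r" _ "smult r N + smult q M"]) (auto intro: degree_add_le)
qed

lemma bounded_germ_diff:
  assumes "bounded_germ D H g" "bounded_germ D H h"
  shows "bounded_germ D (2 * H\<^sup>2) (\<lambda>m. g m - h m)"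
proof -
  have H: "1 \<le> H" using bounded_germ_ge_1 assms(1) .
  have "1 \<le> H\<^sup>2" using H by (simp add: one_le_power)
  then have zero: "bounded_germ D (2 * H\<^sup>2) (\<lambda>_. 0)"
    by (intro bounded_germ_const) auto
  obtain N q where N: "0 < q" "q \<le> H" "l1 N \<le> H" "degree N \<le> D"
    and g: "\<forall>\<^sub>F m in sequentially. q * int (g m) = poly N (fact m)"
    using assms(1) by (rule bounded_germE)
  obtain M r where M: "0 < r" "r \<le> H" "l1 M \<le> H" "degree M \<le> D"
    and h: "\<forall>\<^sub>F m in sequentially. r * int (h m) = poly M (fact m)"
    using assms(2) by (rule bounded_germE)
  have "q * r \<le> H * H" "r * l1 N \<le> H * H" "q * l1 M \<le> H * H"
    using N M by (auto intro!: mult_mono)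
  moreover have "l1 (smult r N - smult q M) \<le> r * l1 N + q * l1 M"
    using l1_diff[of "smult r N" "smult q M"] N M by simp
  moreover have "0 \<le> H * H" by simp
  ultimately have *: "q * r \<le> 2 * H\<^sup>2" "l1 (smult r N - smult q M) \<le> 2 * H\<^sup>2"
    unfolding power2_eq_square by linarith+
  have "germ g" "germ h" using assms by (auto intro: bounded_germ_imp_germ)
  then show ?thesis
  proof (cases rule: germ_cases)
    case 1
    then have "\<forall>\<^sub>F m in sequentially. 0 = g m - h m" by eventually_elim simp
    with zero show ?thesis by (rule bounded_germ_cong)
  next
    case 2
    then have "\<forall>\<^sub>F m in sequentially. 0 = g m - h m" by eventually_elim simp
    with zero show ?thesis by (rule bounded_germ_cong)
  next
    case 3
    with g h have "\<forall>\<^sub>F m in sequentially.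
        q * r * int (g m - h m) = poly (smult r N - smult q M) (fact m)"
    proof eventually_elim
      case (elim m)
      then show ?case by (simp add: of_nat_diff algebra_simps flip: elim(1,2))
    qed
    then show ?thesis
      using N M * by (intro bounded_germI[of "q * r" _ "smult r N - smult q M"]) (auto intro: degree_diff_le)
  qed
qed

text \<open>Among the four operations, this is the only one that raises the degree bound.\<close>

lemma bounded_germ_mult:
  assumes "bounded_germ D H g" "bounded_germ D H h"
  shows "bounded_germ (2 * D) (H\<^sup>2) (\<lambda>m. g m * h m)"
proof -
  obtain N q where N: "0 < q" "q \<le> H" "l1 N \<le> H" "degree N \<le> D"
    and g: "\<forall>\<^sub>F m in sequentially. q * int (g m) = poly N (fact m)"
    using assms(1) by (rule bounded_germE)
  obtain M r where M: "0 < r" "r \<le> H" "l1 M \<le> H" "degree M \<le> D"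
    and h: "\<forall>\<^sub>F m in sequentially. r * int (h m) = poly M (fact m)"
    using assms(2) by (rule bounded_germE)
  have "q * r \<le> H * H" "l1 N * l1 M \<le> H * H"
    using N M by (auto intro!: mult_mono)
  then have *: "q * r \<le> H\<^sup>2" "l1 (N * M) \<le> H\<^sup>2"
    unfolding power2_eq_square using l1_mult[of N M] by linarith+
  have "\<forall>\<^sub>F m in sequentially. q * r * int (g m * h m) = poly (N * M) (fact m)"
    using g h
  proof eventually_elim
    case (elim m)
    show ?case by (simp add: algebra_simps flip: elim)
  qed
  then show ?thesis
    using N M * degree_mult_le[of N M] by (intro bounded_germI[of "q * r"]) auto
qed

lemma lead_coeff_add_lower:
  fixes M R :: "int poly"
  assumes "M \<noteq> 0" "\<forall>i\<ge>degree M. coeff R i = 0"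
  shows "lead_coeff (M + R) = lead_coeff M"
proof -
  have "degree (M + R) \<le> degree M"
    using assms(2) by (intro degree_le) (auto simp: coeff_eq_0)
  moreover have "degree M \<le> degree (M + R)"
    using assms by (intro le_degree) auto
  ultimately have "degree (M + R) = degree M" by simp
  then show ?thesis using assms(2) by simp
qed

lemma dvd_poly_diff_0: "x dvd poly Q x - poly Q (0 :: int)"
  by (cases Q) simp

text \<open>The purpose of the factorials: together with \<open>dvd_poly_diff_0\<close>, the residue
  of \<open>poly Q (fact m)\<close> modulo a fixed \<open>c\<close> is eventually that of
  \<open>poly Q 0\<close>.\<close>

lemma eventually_dvd_fact:
  assumes "0 < (c :: int)"
  shows "\<forall>\<^sub>F m in sequentially. c dvd fact m"
proof -
  have "c dvd fact m" if "nat c \<le> m" for m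
  proof -
    have "nat c dvd fact m" using assms that by (intro dvd_fact) auto
    then have "int (nat c) dvd int (fact m)" by (simp only: int_dvd_int_iff)
    then show ?thesis using assms by simp
  qed
  then show ?thesis by (auto simp: eventually_sequentially)
qed

text \<open>Pseudo-division makes a multiple \<open>c * g\<close> equal to
  \<open>r * Q * h + R\<close> with \<open>R\<close> eventually smaller than \<open>h\<close> in
  absolute value. Then \<open>c * (g div h)\<close> differs from \<open>r * Q\<close> by a bounded
  error, whose residue modulo \<open>c\<close> is eventually fixed.\<close>

lemma bounded_germ_div:
  assumes "bounded_germ D H g" "bounded_germ D H h"
  shows "bounded_germ D ((4 * H) ^ (D + 4)) (\<lambda>m. g m div h m)"
proof -
  have H: "1 \<le> H" using bounded_germ_ge_1 assms(1) .
  have "germ h" using assms(2) by (rule bounded_germ_imp_germ)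
  then show ?thesis using germ_const[of 0]
  proof (cases rule: germ_cases)
    case 1
    then show ?thesis by simp
  next
    case 2
    have "1 \<le> (4 * H) ^ (D + 4)" using H by (intro one_le_power) auto
    then have "bounded_germ D ((4 * H) ^ (D + 4)) (\<lambda>_. 0)" by (intro bounded_germ_const) auto
    moreover from 2 have "\<forall>\<^sub>F m in sequentially. 0 = g m div h m" by eventually_elim simp
    ultimately show ?thesis by (rule bounded_germ_cong)
  next
    case pos: 3
    obtain N q where N: "0 < q" "q \<le> H" "l1 N \<le> H" "degree N \<le> D"
      and g: "\<forall>\<^sub>F m in sequentially. q * int (g m) = poly N (fact m)"
      using assms(1) by (rule bounded_germE)
    obtain M r where M: "0 < r" "r \<le> H" "l1 M \<le> H" "degree M \<le> D"
      and h: "\<forall>\<^sub>F m in sequentially. r * int (h m) = poly M (fact m)"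
      using assms(2) by (rule bounded_germE)
    define l where "l = lead_coeff M"
    from h pos have Mpos: "\<forall>\<^sub>F m in sequentially. 0 < poly M (fact m)"
    proof eventually_elim
      case (elim m)
      have "0 < r * int (h m)" using M(1) elim(2) by simp
      then show ?case using elim(1) by simp
    qed
    have l: "0 < l"
    proof (rule ccontr)
      assume "\<not> 0 < l"
      then consider "M = 0" | "0 < lead_coeff (- M)"
        unfolding l_def by (metis lead_coeff_minus leading_coeff_0_iff linorder_neqE_linordered_idom neg_0_less_iff_less)
      then have "\<forall>\<^sub>F m in sequentially. poly M (fact m) \<le> 0"
      proof cases
        case 2
        from eventually_poly_fact_pos[OF this] show ?thesis by eventually_elim simp
      qed simp
      with Mpos have "\<forall>\<^sub>F m :: nat in sequentially. False" by eventually_elim simp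
      then show False by simp
    qed
    then have M0: "M \<noteq> 0" unfolding l_def by auto
    have lH: "l \<le> H" unfolding l_def using abs_coeff_le_l1[of M "degree M"] M(3) by linarith
    \<comment> \<open>As \<open>degree N \<le> D\<close>, \<open>Suc D\<close> rounds suffice
      whatever the degree of \<open>M\<close>, and they keep the degree of \<open>Q\<close> at most
      \<open>D\<close>.\<close>
    obtain Q R where QR: "smult (l ^ Suc D) N = Q * M + R" "\<forall>i\<ge>degree M. coeff R i = 0"
      "\<forall>i\<ge>Suc D. coeff Q i = 0" "l1 Q \<le> H * (4 * H) ^ Suc D"
      using pseudo_division[of M H "Suc D" N H] M N H unfolding l_def by (auto simp: coeff_eq_0)
    define c where "c = l ^ Suc D * q"
    have c: "0 < c" using l N(1) by (simp add: c_def)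
    have E1: "\<forall>\<^sub>F m in sequentially. c * int (g m) = r * poly Q (fact m) * int (h m) + poly R (fact m)"
      using g h
    proof eventually_elim
      case (elim m)
      have "l ^ Suc D * poly N (fact m) = poly Q (fact m) * poly M (fact m) + poly R (fact m)"
        using arg_cong[OF QR(1), of "\<lambda>p. poly p (fact m)"] by simp
      then show ?case by (simp add: c_def mult_ac flip: elim)
    qed
    have E2: "\<forall>\<^sub>F m in sequentially. \<bar>poly R (fact m)\<bar> < int (h m)"
    proof -
      \<comment> \<open>Lower-order terms leave the leading coefficient unchanged, so
        \<open>r * (h + R)\<close> and \<open>r * (h - R)\<close> are eventually positive.\<close>
      have "lead_coeff (M + smult r R) = l" "lead_coeff (M + smult (- r) R) = l"
        unfolding l_def using M0 QR(2) by (intro lead_coeff_add_lower; simp)+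
      then have "0 < lead_coeff (M + smult r R)" "0 < lead_coeff (M + smult (- r) R)"
        using l by (simp_all only:)
      note eventually_poly_fact_pos[OF this(1)] eventually_poly_fact_pos[OF this(2)]
      with h show ?thesis
      proof eventually_elim
        case (elim m)
        have "0 < r * (int (h m) + poly R (fact m))" "0 < r * (int (h m) - poly R (fact m))"
          using elim by (auto simp: algebra_simps)
        then show ?case using M(1) by (auto simp: zero_less_mult_iff abs_less_iff)
      qed
    qed
    \<comment> \<open>The rounding error \<open>e\<close> lies in \<open>[-c, 0]\<close> and is determined modulo \<open>c\<close>, since \<open>c\<close> divides \<open>m!\<close>;
      the sign of \<open>R\<close> decides between the endpoints \<open>-c\<close> and \<open>0\<close>. So \<open>e\<close> is eventually constant.\<close>
    define e where "e m = c * int (g m div h m) - r * poly Q (fact m)" for m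
    have E3: "\<forall>\<^sub>F m in sequentially. e m * int (h m) = poly R (fact m) - c * int (g m mod h m)"
      using E1
    proof eventually_elim
      case (elim m)
      have "int (g m) = int (g m div h m) * int (h m) + int (g m mod h m)"
        by (metis div_mult_mod_eq of_nat_add of_nat_mult)
      then show ?case using elim by (simp add: e_def algebra_simps)
    qed
    have E4: "\<forall>\<^sub>F m in sequentially. - c \<le> e m \<and> e m \<le> 0 \<and>
        (e m = - c \<longrightarrow> poly R (fact m) < 0) \<and> (e m = 0 \<longrightarrow> 0 \<le> poly R (fact m))"
      using E2 E3 pos
    proof eventually_elim
      case (elim m)
      define x where "x = int (g m mod h m)"
      have x: "0 \<le> x" "x < int (h m)" using elim(3) by (auto simp: x_def)
      have cx: "0 \<le> c * x" "c * x \<le> c * (int (h m) - 1)" using c x by auto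
      have eq: "e m * int (h m) = poly R (fact m) - c * x" using elim(2) by (simp add: x_def)
      have "e m * int (h m) < 1 * int (h m)" using eq cx elim(1) by linarith
      then have "e m < 1" using elim(3) by (simp only: mult_less_cancel_right_pos of_nat_0_less_iff)
      moreover have "(- c - 1) * int (h m) < e m * int (h m)"
        using eq cx elim(1) c by (simp add: algebra_simps; linarith)
      then have "- c - 1 < e m" using elim(3) by (simp only: mult_less_cancel_right_pos of_nat_0_less_iff)
      moreover have "poly R (fact m) < 0" if "e m = - c"
        using eq cx c that by (simp add: algebra_simps)
      moreover have "0 \<le> poly R (fact m)" if "e m = 0" using eq cx that by simp
      ultimately show ?case by auto
    qed
    have E5: "\<forall>\<^sub>F m in sequentially. c dvd e m + r * poly Q 0"
      using eventually_dvd_fact[OF c]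
    proof eventually_elim
      case (elim m)
      have "c dvd poly Q (fact m) - poly Q 0" using elim dvd_poly_diff_0 dvd_trans by blast
      then have "c dvd c * int (g m div h m) - r * (poly Q (fact m) - poly Q 0)" by simp
      then show ?case by (simp add: e_def algebra_simps)
    qed
    have "\<exists>e0. \<bar>e0\<bar> \<le> c \<and> (\<forall>\<^sub>F m in sequentially. e m = e0)"
    proof (cases "\<forall>\<^sub>F m in sequentially. poly R (fact m) < 0")
      case True
      with E4 E5 have "\<forall>\<^sub>F m in sequentially. e m = (- r * poly Q 0) mod c - c"
      proof eventually_elim
        case (elim m)
        have "(e m + c) mod c = (- r * poly Q 0) mod c"
          using elim(2) by (simp add: mod_eq_dvd_iff)
        moreover have "(e m + c) mod c = e m + c"
          using elim(1,3) c by (intro mod_pos_pos_trivial) (auto simp: less_le)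
        ultimately show ?case by simp
      qed
      moreover have "\<bar>(- r * poly Q 0) mod c - c\<bar> \<le> c"
        using pos_mod_bound[OF c, of "- r * poly Q 0"] pos_mod_sign[OF c, of "- r * poly Q 0"] by linarith
      ultimately show ?thesis by blast
    next
      case False
      \<comment> \<open>Not being eventually negative means being eventually nonnegative, by the
        sign trichotomy.\<close>
      then have "\<forall>\<^sub>F m in sequentially. 0 \<le> poly R (fact m)"
        by (cases R rule: poly_fact_sign_cases) (auto elim: eventually_mono)
      with E4 E5 have "\<forall>\<^sub>F m in sequentially. e m = - ((r * poly Q 0) mod c)"
      proof eventually_elim
        case (elim m)
        have "(- e m) mod c = (r * poly Q 0) mod c"
          using elim(2) by (metis add.inverse_inverse diff_minus_eq_add dvd_minus_iff minus_add_distrib mod_eq_dvd_iff uminus_add_conv_diff add.commute)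
        moreover have "(- e m) mod c = - e m"
          using elim(1,3) c by (intro mod_pos_pos_trivial) (auto simp: less_le)
        ultimately show ?case by simp
      qed
      moreover have "\<bar>- ((r * poly Q 0) mod c)\<bar> \<le> c"
        using pos_mod_bound[OF c, of "r * poly Q 0"] pos_mod_sign[OF c, of "r * poly Q 0"] by linarith
      ultimately show ?thesis by blast
    qed
    then obtain e0 where e0: "\<bar>e0\<bar> \<le> c" "\<forall>\<^sub>F m in sequentially. e m = e0" by blast
    have ev: "\<forall>\<^sub>F m in sequentially. c * int (g m div h m) = poly (smult r Q + [:e0:]) (fact m)"
      using e0(2) by eventually_elim (simp add: e_def)
    have "c \<le> H ^ Suc D * H"
      unfolding c_def using l lH N H by (intro mult_mono power_mono) auto
    also have "\<dots> = 1 * H ^ (D + 2)" by simp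
    also have "\<dots> \<le> (4 * H) * (4 * H) ^ (D + 2)" using H by (intro mult_mono power_mono) auto
    finally have c1: "c \<le> (4 * H) ^ (D + 3)" by (simp add: eval_nat_numeral)
    have "l1 (smult r Q) \<le> H * (H * (4 * H) ^ Suc D)"
      using M QR(4) H by (auto intro!: mult_mono)
    also have "\<dots> \<le> (4 * H) * ((4 * H) * (4 * H) ^ Suc D)"
      using H by (intro mult_mono) auto
    finally have c2: "l1 (smult r Q) \<le> (4 * H) ^ (D + 3)" by (simp add: eval_nat_numeral)
    have "2 * (4 * H) ^ (D + 3) \<le> (4 * H) * (4 * H) ^ (D + 3)"
      using H by (intro mult_right_mono) auto
    \<comment> \<open>The numerator has two summands, \<open>smult r Q\<close> and
      \<open>e0\<close>, each bounded with exponent \<open>D + 3\<close>; one more factor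
      \<open>4 * H\<close> pays for the sum.\<close>
    then have c3: "2 * (4 * H) ^ (D + 3) \<le> (4 * H) ^ (D + 4)" by (simp add: eval_nat_numeral)
    have "l1 (smult r Q + [:e0:]) \<le> (4 * H) ^ (D + 4)"
      using l1_add[of "smult r Q" "[:e0:]"] c1 c2 c3 e0(1) by simp
    moreover have "c \<le> (4 * H) ^ (D + 4)" using c1 c3 c by linarith
    moreover have "degree (smult r Q + [:e0:]) \<le> D"
      using QR(3) by (intro degree_add_le order_trans[OF degree_smult_le] degree_le)
        (auto simp: coeff_pCons split: nat.split)
    ultimately show ?thesis using c ev by (intro bounded_germI)
  qed
qed

text \<open>A polynomial that eventually takes the value \<open>q * y\<close> along the factorials
  is constant, so its coefficient sum is \<open>q * y\<close>, which is at least
  \<open>y\<close>.\<close>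

lemma bounded_germ_const_le:
  assumes "bounded_germ D H (\<lambda>_. y)"
  shows "int y \<le> H"
proof -
  obtain N q where N: "0 < q" "q \<le> H" "l1 N \<le> H"
    and g: "\<forall>\<^sub>F m in sequentially. q * int y = poly N (fact m)"
    using assms by (rule bounded_germE)
  have g0: "\<forall>\<^sub>F m in sequentially. poly (N - [:q * int y:]) (fact m) = 0"
    using g by eventually_elim simp
  have "N - [:q * int y:] = 0"
  proof (cases "N - [:q * int y:]" rule: poly_fact_sign_cases)
    case 1
    with g0 have "\<forall>\<^sub>F m :: nat in sequentially. False" by eventually_elim simp
    then show ?thesis by simp
  next
    case 3
    with g0 have "\<forall>\<^sub>F m :: nat in sequentially. False" by eventually_elim simp
    then show ?thesis by simp
  qed
  then have "q * int y \<le> H" using N by auto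
  moreover have "1 * int y \<le> q * int y" using N by (intro mult_right_mono) auto
  ultimately show ?thesis by simp
qed

section \<open>Symbolic execution of an ARAM\<close>

text \<open>Whether the address read coincides with the address written is eventually
  decided.\<close>

lemma bounded_germ_update:
  assumes "germ x" "germ a" "bounded_germ D H v" "bounded_germ D H (\<lambda>m. R m (a m))"
  shows "bounded_germ D H (\<lambda>m. ((R m)(x m := v m)) (a m))"
  using assms(2,1)
proof (cases rule: germ_cases)
  case 1
  then have "\<forall>\<^sub>F m in sequentially. R m (a m) = ((R m)(x m := v m)) (a m)" by eventually_elim simp
  with assms(4) show ?thesis by (rule bounded_germ_cong)
next
  case 2
  then have "\<forall>\<^sub>F m in sequentially. v m = ((R m)(x m := v m)) (a m)" by eventually_elim simp
  with assms(3) show ?thesis by (rule bounded_germ_cong)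
next
  case 3
  then have "\<forall>\<^sub>F m in sequentially. R m (a m) = ((R m)(x m := v m)) (a m)" by eventually_elim simp
  with assms(4) show ?thesis by (rule bounded_germ_cong)
qed

text \<open>
  Quantifying over all germs of addresses covers indirect addressing without an explicit symbolic
  memory: two address germs are either eventually equal or eventually distinct.
\<close>
definition symbolic :: "nat \<Rightarrow> int \<Rightarrow> (nat \<Rightarrow> config) \<Rightarrow> bool" where
  "symbolic D H c \<longleftrightarrow> (\<exists>pc. \<forall>\<^sub>F m in sequentially. fst (c m) = pc) \<and>
     (\<forall>a. germ a \<longrightarrow> bounded_germ D H (\<lambda>m. fst (snd (c m)) (a m)))"

lemma symbolic_cong:
  assumes "symbolic D H c" "\<forall>\<^sub>F m in sequentially. c m = c' m"
  shows "symbolic D H c'"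
proof -
  obtain pc where pc: "\<forall>\<^sub>F m in sequentially. fst (c m) = pc"
    and mem: "\<And>a. germ a \<Longrightarrow> bounded_germ D H (\<lambda>m. fst (snd (c m)) (a m))"
    using assms(1) unfolding symbolic_def by blast
  have "\<forall>\<^sub>F m in sequentially. fst (c' m) = pc" using pc assms(2) by eventually_elim simp
  moreover have "bounded_germ D H (\<lambda>m. fst (snd (c' m)) (a m))" if "germ a" for a
    by (rule bounded_germ_cong[OF mem[OF that]]) (use assms(2) in \<open>eventually_elim, simp\<close>)
  ultimately show ?thesis unfolding symbolic_def by blast
qed

lemma symbolic_mono: "symbolic D H c \<Longrightarrow> D \<le> D' \<Longrightarrow> H \<le> H' \<Longrightarrow> symbolic D' H' c"
  unfolding symbolic_def by (blast intro: bounded_germ_mono)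

lemma symbolic_update:
  assumes "germ x" "bounded_germ D H v" "\<And>a. germ a \<Longrightarrow> bounded_germ D H (\<lambda>m. R m (a m))"
  shows "symbolic D H (\<lambda>m. (pc, (R m)(x m := v m), k m))"
  unfolding symbolic_def using assms by (auto simp del: fun_upd_apply intro: bounded_germ_update)

text \<open>The program counter is eventually fixed, so eventually the same instruction is executed
  for all \<open>m\<close>. Multiplication dictates the new degree bound and division the new
  height.\<close>

lemma symbolic_step:
  assumes "no_aln r" "symbolic D H c" "\<And>i k. Cnst i k \<in> set r \<Longrightarrow> int k \<le> H"
  shows "symbolic (2 * D) ((4 * H) ^ (D + 4)) (\<lambda>m. step r s (c m))"
proof -
  define D' H' where "D' = 2 * D" and "H' = (4 * H) ^ (D + 4)"
  define R where "R m = fst (snd (c m))" for m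
  define n where "n m = snd (snd (c m))" for m
  obtain pc where pc: "\<forall>\<^sub>F m in sequentially. fst (c m) = pc"
    and mem: "\<And>a. germ a \<Longrightarrow> bounded_germ D H (\<lambda>m. R m (a m))"
    using assms(2) unfolding symbolic_def R_def by blast
  have reg: "bounded_germ D H (\<lambda>m. R m i)" for i using mem germ_const by blast
  have H: "1 \<le> H" using bounded_germ_ge_1 reg .
  have H1: "H \<le> H'" "2 * H\<^sup>2 \<le> H'" "H\<^sup>2 \<le> H'"
  proof -
    have "(4 * H)\<^sup>2 \<le> H'" unfolding H'_def using H by (intro power_increasing) auto
    moreover have "H * 1 \<le> H * H" using H by (intro mult_left_mono) auto
    moreover have "(4 * H)\<^sup>2 = 16 * (H * H)" by (simp add: power2_eq_square)
    ultimately show "H \<le> H'" "2 * H\<^sup>2 \<le> H'" "H\<^sup>2 \<le> H'"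
      using H unfolding power2_eq_square by linarith+
  qed
  have D1: "D \<le> D'" by (simp add: D'_def)
  have mem': "\<And>a. germ a \<Longrightarrow> bounded_germ D' H' (\<lambda>m. R m (a m))"
    using mem D1 H1(1) by (blast intro: bounded_germ_mono)
  note up = symbolic_update[OF germ_const _ mem']
  have c: "\<forall>\<^sub>F m in sequentially. c m = (pc, R m, n m)"
    using pc by eventually_elim (simp add: R_def n_def prod_eq_iff)
  have "\<exists>c'. symbolic D' H' c' \<and> (\<forall>\<^sub>F m in sequentially. c' m = step r s (c m))"
  proof (cases "pc < length r \<and> r ! pc \<noteq> Halt")
    case False
    have "\<forall>\<^sub>F m in sequentially. c m = step r s (c m)"
      using c by eventually_elim (use False in \<open>simp add: step_def halted_def\<close>)
    moreover have "symbolic D' H' c" using assms(2) D1 H1(1) by (rule symbolic_mono)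
    ultimately show ?thesis by blast
  next
    case True
    then have inr: "r ! pc \<in> set r" by simp
    have st: "\<forall>\<^sub>F m in sequentially. exec (r ! pc) s (pc, R m, n m) = step r s (c m)"
      using c by eventually_elim (use True in \<open>simp add: step_def halted_def\<close>)
    moreover have "symbolic D' H' (\<lambda>m. exec (r ! pc) s (pc, R m, n m))"
    proof (cases "r ! pc")
      case (Cnst i k)
      then have "bounded_germ D' H' (\<lambda>_. k)"
        using assms(3)[of i k] inr H H1(1) by (intro bounded_germ_const) auto
      then show ?thesis using up Cnst by simp
    next
      case (Cpy i j)
      have "bounded_germ D' H' (\<lambda>m. R m j)" using mem' germ_const by blast
      then show ?thesis using up Cpy by simp
    next
      case (Ld i j)
      \<comment> \<open>The content of a register is itself a germ and thus an admissible
        address.\<close>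
      have "bounded_germ D' H' (\<lambda>m. R m (R m j))" using mem' reg bounded_germ_imp_germ by blast
      then show ?thesis using up Ld by simp
    next
      case (St i j)
      have "bounded_germ D' H' (\<lambda>m. R m j)" using mem' germ_const by blast
      then show ?thesis using symbolic_update[OF bounded_germ_imp_germ[OF reg[of i]] _ mem'] St by simp
    next
      case (Add i j k)
      have "bounded_germ D' H' (\<lambda>m. R m j + R m k)"
        using bounded_germ_add[OF reg reg] D1 H1(2) by (rule bounded_germ_mono)
      then show ?thesis using up Add by simp
    next
      case (Sub i j k)
      have "bounded_germ D' H' (\<lambda>m. R m j - R m k)"
        using bounded_germ_diff[OF reg reg] D1 H1(2) by (rule bounded_germ_mono)
      then show ?thesis using up Sub by simp
    next
      case (Mul i j k)
      have "bounded_germ D' H' (\<lambda>m. R m j * R m k)"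
        using bounded_germ_mult[OF reg reg] _ H1(3) by (rule bounded_germ_mono) (simp add: D'_def)
      then show ?thesis using up Mul by simp
    next
      case (Dv i j k)
      have "bounded_germ D' H' (\<lambda>m. R m j div R m k)"
        using bounded_germ_div[OF reg reg] D1 unfolding H'_def by (rule bounded_germ_mono) simp
      then show ?thesis using up Dv by simp
    next
      case (Jeq i j l)
      have "germ (\<lambda>m. R m i)" "germ (\<lambda>m. R m j)" using reg bounded_germ_imp_germ by blast+
      then have "\<exists>pc'. \<forall>\<^sub>F m in sequentially. (if R m i = R m j then l else Suc pc) = pc'"
      proof (cases rule: germ_cases)
        case 1
        then have "\<forall>\<^sub>F m in sequentially. (if R m i = R m j then l else Suc pc) = Suc pc"
          by eventually_elim simp
        then show ?thesis ..
      next
        case 2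
        then have "\<forall>\<^sub>F m in sequentially. (if R m i = R m j then l else Suc pc) = l"
          by eventually_elim simp
        then show ?thesis ..
      next
        case 3
        then have "\<forall>\<^sub>F m in sequentially. (if R m i = R m j then l else Suc pc) = Suc pc"
          by eventually_elim simp
        then show ?thesis ..
      qed
      then show ?thesis using mem' Jeq by (simp add: symbolic_def)
    next
      case (Aln i)
      then show ?thesis using assms(1) inr by (auto simp: no_aln_def)
    next
      case Halt
      then show ?thesis using True by simp
    qed
    ultimately show ?thesis by blast
  qed
  then show ?thesis unfolding D'_def H'_def by (blast intro: symbolic_cong)
qed

lemma symbolic_init:
  assumes "1 \<le> H" "int inp \<le> H"
  shows "symbolic 1 H (\<lambda>m. init [inp, fact m])"
proof -
  have "bounded_germ 1 H (\<lambda>m. ((\<lambda>_. 0)(1 := fact m, 0 := inp)) (a m))" if "germ a" for a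
    using assms that
    by (intro bounded_germ_update germ_const bounded_germ_const bounded_germ_fact) auto
  moreover have "init [inp, fact m] = (0, (\<lambda>_. 0)(1 := fact m, 0 := inp), 0)" for m
    by (auto simp: init_def fun_eq_iff less_Suc_eq)
  ultimately show ?thesis unfolding symbolic_def by auto
qed

section \<open>Double exponential bound on ARAM outputs\<close>

lemma height_recurrence:
  fixes h :: int
  assumes "4 \<le> h"
  shows "(4 * h ^ 2 ^ (t * (t + 4))) ^ (2 ^ t + 4) \<le> h ^ 2 ^ (Suc t * (Suc t + 4))"
proof -
  define e :: nat where "e = 2 ^ (t * (t + 4))"
  have "h ^ 1 \<le> h ^ e" using assms by (intro power_increasing) (auto simp: e_def)
  then have "4 * h ^ e \<le> h ^ e * h ^ e" using assms by (intro mult_right_mono) auto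
  then have "4 * h ^ e \<le> h ^ (e * 2)" by (simp add: power_mult power2_eq_square)
  then have "(4 * h ^ e) ^ (2 ^ t + 4) \<le> (h ^ (e * 2)) ^ (2 ^ t + 4)"
    using assms by (intro power_mono) auto
  also have "\<dots> = h ^ (e * (2 * (2 ^ t + 4)))" by (simp add: mult.assoc flip: power_mult)
  also have "\<dots> \<le> h ^ (e * 2 ^ (t + 4))"
  proof -
    \<comment> \<open>For \<open>x = 2 ^ t\<close>: a step multiplies the exponent of
      \<open>h\<close> by at most \<open>2 ^ (t + 4)\<close>, and these factors accumulate to at
      most \<open>2 ^ (t * (t + 4))\<close>.\<close>
    have "2 * (x + 4) \<le> x * 16" if "1 \<le> x" for x :: nat using that by presburger
    from this[of "2 ^ t"] show ?thesis using assms by (intro power_increasing mult_left_mono) (auto simp: power_add)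
  qed
  also have "e * 2 ^ (t + 4) = 2 ^ (t * (t + 4) + (t + 4))" by (simp add: e_def power_add)
  also have "h ^ \<dots> \<le> h ^ 2 ^ (Suc t * (Suc t + 4))"
    using assms by (intro power_increasing) (auto simp: algebra_simps)
  finally show ?thesis unfolding e_def .
qed

lemma symbolic_run:
  assumes "no_aln r" "4 \<le> h" "int inp \<le> h" "\<And>i k. Cnst i k \<in> set r \<Longrightarrow> int k \<le> h"
  shows "symbolic (2 ^ t) (h ^ 2 ^ (t * (t + 4))) (\<lambda>m. run r s [inp, fact m] t)"
proof (induction t)
  case 0
  then show ?case using symbolic_init[of h inp] assms by (simp add: run_0)
next
  case (Suc t)
  have "h ^ 1 \<le> h ^ 2 ^ (t * (t + 4))" using assms(2) by (intro power_increasing) auto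
  then have "int k \<le> h ^ 2 ^ (t * (t + 4))" if "Cnst i k \<in> set r" for i k
    using assms(4)[OF that] by simp
  from symbolic_step[OF assms(1) Suc this, where s = s]
  have "symbolic (2 * 2 ^ t) ((4 * h ^ 2 ^ (t * (t + 4))) ^ (2 ^ t + 4))
      (\<lambda>m. run r s [inp, fact m] (Suc t))" by (simp add: run_Suc)
  then show ?case using height_recurrence[OF assms(2)] by (auto intro: symbolic_mono)
qed

lemma ex_const_bound: "\<exists>C. \<forall>i k. Cnst i k \<in> set r \<longrightarrow> k \<le> C"
proof (induction r)
  case (Cons x r)
  then obtain C where "\<forall>i k. Cnst i k \<in> set r \<longrightarrow> k \<le> C" ..
  then show ?case
    by (intro exI[of _ "max C (case x of Cnst i k \<Rightarrow> k | _ \<Rightarrow> 0)"]) (force simp: max_def)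
qed simp

lemma ARAM_output_bound:
  assumes "no_aln r" "4 \<le> h" "int inp \<le> h" "\<And>i k. Cnst i k \<in> set r \<Longrightarrow> int k \<le> h"
    and halts: "\<And>A. halts_within r s [inp, A] T"
    and fin: "finite {A. \<not> outputs r s [inp, A] y}"
  shows "int y \<le> h ^ 2 ^ (T * (T + 4))"
proof -
  obtain B where B: "\<And>A. B < A \<Longrightarrow> outputs r s [inp, A] y"
    using fin unfolding finite_nat_set_iff_bounded_le by (metis mem_Collect_eq not_le)
  \<comment> \<open>Halted configurations persist, so at the common time \<open>T\<close> all large
    \<open>A\<close> show the output.\<close>
  have out: "fst (snd (run r s [inp, A] T)) 0 = y" if A: "B < A" for A
  proof -
    obtain t where t: "halted r (run r s [inp, A] t)" "fst (snd (run r s [inp, A] t)) 0 = y"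
      using B[OF A] unfolding outputs_def by blast
    obtain t' where t': "t' \<le> T" "halted r (run r s [inp, A] t')"
      using halts unfolding halts_within_def by blast
    have "run r s [inp, A] t' = run r s [inp, A] t"
      using run_stable t(1) t'(2) by (metis nat_le_linear)
    then show ?thesis using t(2) run_stable[OF t'(2,1)] by simp
  qed
  have "bounded_germ (2 ^ T) (h ^ 2 ^ (T * (T + 4))) (\<lambda>m. fst (snd (run r s [inp, fact m] T)) 0)"
  proof -
    have "symbolic (2 ^ T) (h ^ 2 ^ (T * (T + 4))) (\<lambda>m. run r s [inp, fact m] T)"
      by (rule symbolic_run[OF assms(1-3)]) (rule assms(4))
    then show ?thesis using germ_const[of 0] unfolding symbolic_def by blast
  qed
  moreover have "\<forall>\<^sub>F m in sequentially. fst (snd (run r s [inp, fact m] T)) 0 = y"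
  proof -
    have "B < fact m" if "Suc B \<le> m" for m
      using that fact_ge_self[of m] by linarith
    then show ?thesis using out unfolding eventually_sequentially by blast
  qed
  ultimately have "bounded_germ (2 ^ T) (h ^ 2 ^ (T * (T + 4))) (\<lambda>_. y)"
    by (rule bounded_germ_cong)
  then show ?thesis by (rule bounded_germ_const_le)
qed

section \<open>Exponentials against polynomials, and the separation\<close>

lemma power_le_power2: "n ^ k \<le> k ^ k * (2 :: nat) ^ n"
proof (cases "k = 0")
  case False
  define q where "q = n div k"
  have "n \<le> k * Suc q"
    using False mod_less_divisor[of k n] mult_div_mod_eq[of k n] unfolding q_def mult_Suc_right by linarith
  also have "\<dots> \<le> k * 2 ^ q" by (intro mult_left_mono Suc_leI less_exp) auto
  finally have "n ^ k \<le> (k * 2 ^ q) ^ k" by (rule power_mono) simp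
  also have "\<dots> = k ^ k * 2 ^ (q * k)" by (simp add: power_mult_distrib power_mult)
  also have "\<dots> \<le> k ^ k * 2 ^ n" by (intro mult_left_mono power_increasing) (auto simp: q_def)
  finally show ?thesis .
qed simp

lemma power2_dominates_poly: "\<exists>n. (a :: nat) * (n + b) ^ k < 2 ^ n"
proof -
  define K where "K = Suc k ^ Suc k * (2 :: nat) ^ b"
  \<comment> \<open>One spare factor \<open>n + b\<close> exceeds \<open>a * K\<close>, while the
    power with exponent \<open>Suc k\<close> is still at most \<open>K * 2 ^ n\<close>.\<close>
  define n where "n = Suc (a * K)"
  have K: "0 < K" by (simp add: K_def)
  have "K * (a * (n + b) ^ k) < (n + b) * (n + b) ^ k"
    unfolding mult.assoc[symmetric] by (intro mult_strict_right_mono) (auto simp: n_def)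
  also have "\<dots> \<le> Suc k ^ Suc k * 2 ^ (n + b)" using power_le_power2[of "n + b" "Suc k"] by simp
  also have "\<dots> = K * 2 ^ n" by (simp add: K_def power_add)
  finally show ?thesis using K by auto
qed

text \<open>On the inputs \<open>2 ^ n\<close>, two logarithms of the output bound leave
  \<open>2 ^ Suc n\<close> below a polynomial in \<open>n\<close>.\<close>

lemma not_ARAM_triple_exp: "\<not> ARAM_ptime (\<lambda>inp. 2 ^ 2 ^ 2 ^ bitlen inp)"
proof
  assume "ARAM_ptime (\<lambda>inp. 2 ^ 2 ^ 2 ^ bitlen inp)"
  then obtain r c k where r: "no_aln r"
    and halts: "\<And>inp A. halts_within r (\<lambda>_. 0) [inp, A] (poly_bound c k inp)"
    and fin: "\<And>inp. finite {A. \<not> outputs r (\<lambda>_. 0) [inp, A] (2 ^ 2 ^ 2 ^ bitlen inp)}"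
    unfolding ARAM_ptime_def by blast
  obtain C where C: "\<And>i k. Cnst i k \<in> set r \<Longrightarrow> k \<le> C" using ex_const_bound by blast
  have key: "(2 :: nat) ^ Suc n \<le> (C + 2 + n) + c * (n + 2) ^ k * (c * (n + 2) ^ k + 4)" for n
  proof -
    define inp :: nat where "inp = 2 ^ n"
    define T where "T = c * (n + 2) ^ k"
    have b: "bitlen inp = Suc n" by (simp add: inp_def bitlen_power2)
    then have T: "poly_bound c k inp = T" by (simp add: poly_bound_def T_def)
    \<comment> \<open>A power of two, to ease taking logarithms, that dominates the program
      constants, 4 and the input.\<close>
    define h :: int where "h = 2 ^ (C + 2 + n)"
    have "(2 :: nat) ^ C > C" by simp
    then have pC: "int C < 2 ^ C" by (metis of_nat_less_iff of_nat_numeral of_nat_power)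
    have h1: "(2 :: int) ^ C \<le> h" "(2 :: int) ^ 2 \<le> h" "(2 :: int) ^ n \<le> h"
      unfolding h_def by (intro power_increasing; simp)+
    have "int (2 ^ 2 ^ 2 ^ Suc n) \<le> h ^ 2 ^ (T * (T + 4))"
    proof (rule ARAM_output_bound[OF r])
      show "4 \<le> h" using h1(2) by simp
      show "int inp \<le> h" using h1(3) by (simp add: inp_def)
      show "int k \<le> h" if "Cnst i k \<in> set r" for i k using C[OF that] pC h1(1) by linarith
      show "halts_within r (\<lambda>_. 0) [inp, A] T" for A using halts[of inp A] T by simp
      show "finite {A. \<not> outputs r (\<lambda>_. 0) [inp, A] (2 ^ 2 ^ 2 ^ Suc n)}" using fin[of inp] b by simp
    qed
    also have "\<dots> = 2 ^ ((C + 2 + n) * 2 ^ (T * (T + 4)))" by (simp only: h_def power_mult)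
    \<comment> \<open>Weakening the first factor by \<open>x < 2 ^ x\<close> turns the exponent into
      a single power of two.\<close>
    also have "\<dots> \<le> 2 ^ (2 ^ (C + 2 + n) * 2 ^ (T * (T + 4)))"
      by (intro power_increasing mult_right_mono less_imp_le[OF less_exp]) simp_all
    also have "\<dots> = 2 ^ 2 ^ (C + 2 + n + T * (T + 4))" by (simp only: power_add)
    finally have "(2 :: int) ^ 2 ^ 2 ^ Suc n \<le> 2 ^ 2 ^ (C + 2 + n + T * (T + 4))"
      by (simp only: of_nat_power of_nat_numeral)
    then have "(2 :: nat) ^ 2 ^ Suc n \<le> 2 ^ (C + 2 + n + T * (T + 4))"
      by (simp only: power_increasing_iff one_less_numeral_iff semiring_norm)
    then have "(2 :: nat) ^ Suc n \<le> C + 2 + n + T * (T + 4)"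
      by (simp only: power_increasing_iff one_less_numeral_iff semiring_norm)
    then show ?thesis by (simp only: T_def)
  qed
  \<comment> \<open>The exponent \<open>2 * k + 1\<close> dominates both \<open>n + 2\<close> and
    the square of \<open>(n + 2) ^ k\<close>; the coefficient collects those of the two summands in
    \<open>key\<close>.\<close>
  obtain n where n: "(C + 2 + c * (c + 4)) * (n + 2) ^ (2 * k + 1) < 2 ^ n"
    using power2_dominates_poly by blast
  define X where "X = (n + 2) ^ k"
  define Y where "Y = (n + 2) ^ (2 * k + 1)"
  have "(n + 2) ^ 1 \<le> Y" unfolding Y_def by (intro power_increasing) auto
  moreover have "X * X \<le> Y" "X \<le> X * X" by (simp_all add: X_def Y_def mult_2 power_add)
  ultimately have XY: "X * X \<le> Y" "n + 2 \<le> Y" "X \<le> Y"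
    unfolding power_one_right by linarith+
  have "C * 1 \<le> C * Y" using XY(2) by (intro mult_left_mono) auto
  then have "C + 2 + n \<le> (C + 2) * Y" using XY(2) unfolding distrib_right by linarith
  moreover have "c * X * (c * X + 4) \<le> c * (c + 4) * Y"
  proof -
    have "c * X * (c * X + 4) = c * c * (X * X) + 4 * c * X" by (simp add: algebra_simps)
    also have "\<dots> \<le> c * c * Y + 4 * c * Y" using XY by (intro add_mono mult_left_mono) auto
    finally show ?thesis by (simp add: algebra_simps)
  qed
  ultimately have "(2 :: nat) ^ Suc n \<le> (C + 2 + c * (c + 4)) * Y"
    using key[of n] unfolding X_def[symmetric] distrib_right by linarith
  then have "(2 :: nat) ^ Suc n < 2 ^ n" using n unfolding Y_def by (rule le_less_trans)
  then show False by simp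
qed

theorem theorem1:
  shows "{f. ARAM_ptime f} \<subset> {f. ASRAM_ptime f}"
  using ARAM_imp_ASRAM ASRAM_triple_exp not_ARAM_triple_exp by blast

end
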